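(* Let $(\Omega,\mathcal A,\mu)$ be a measure space and let $1\le p<\infty$. (a) Let $\mu=\mu'+\mu''$ be a locally disjoint decomposition of $\mu$ (that is, $\mu',\mu''$ are measures on $\mathcal A$ with $\mu=\mu'+\mu''$ and $\mu'\perp_{\mathrm{loc}}\mu''$). Then $$M:=\{f\in L_p(\mu) : f=0\ \ \mu''\text{-a.e.}\}$$ is a band in $L_p(\mu)$, and its disjoint complement is $$M^\perp=\{f\in L_p(\mu) : f=0\ \ \mu'\text{-a.e.}\}.$$ (b) Conversely, for each band $M$ in $L_p(\mu)$ there exists a locally disjoint decomposition $\mu=\mu'+\mu''$ of $\mu$ such that $$M=\{f\in L_p(\mu) : f=0\ \ \mu''\text{-a.e.}\}\quad\text{and}\quad M^\perp=\{f\in L_p(\mu) : f=0\ \ \mu'\text{-a.e.}\}.$$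
   Context: Measure spaces $(\Omega,\mathcal A,\mu)$ are arbitrary: $\mathcal A$ is a $\sigma$-algebra on $\Omega$ and $\mu\colon\mathcal A\to[0,\infty]$ is a (not necessarily $\sigma$-finite) measure. $L_p(\mu)$ is the space of ($\mu$-a.e. equivalence classes of) real-valued $p$-integrable functions, with its usual order. $\mathcal A_{\mathrm{fin}}:=\{A\in\mathcal A : \mu(A)<\infty\}$. Band: a band in a vector lattice $E$ is a lattice ideal $M\subseteq E$ such that, whenever $A\subseteq M$ is a set for which $\sup A$ exists in $E$, one has $\sup A\in M$. Disjoint complement: $M^\perp:=\{f\in L_p(\mu) : |f|\wedge|g|=0 \text{ for all } g\in M\}$. Locally disjoint: if $\mu',\mu''$ are measures on $\mathcal A$ with $\mu'\le\mu$ and $\mu''\le\mu$, then $\mu',\mu''$ are called locally disjoint, written $\mu'\perp_{\mathrm{loc}}\mu''$, if for all $A\in\mathcal A_{\mathrm{fin}}$ there exist $A',A''\in\mathcal A$ with $A=A'\cup A''$, $A'\cap A''=\varnothing$ and $\mu'(A'')=\mu''(A')=0$. The conditions "$f=0$ $\mu'$-a.e." and "$f=0$ $\mu''$-a.e." do not depend on the representative of the $\mu$-equivalence class of $f$, since $\mu',\mu''\le\mu$. *)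

theory Defs
  imports "HOL-Analysis.Analysis" "HOL-Algebra.Lattice"
begin

section \<open>Vector lattices, ideals and bands\<close>

record 'e ordered_vector_space = "'e gorder" +
  vadd :: "'e \<Rightarrow> 'e \<Rightarrow> 'e"
  vzero :: "'e"
  vscale :: "real \<Rightarrow> 'e \<Rightarrow> 'e"

locale vector_lattice = lattice E for E (structure) +
  assumes vadd_closed: "x \<in> carrier E \<Longrightarrow> y \<in> carrier E \<Longrightarrow> vadd E x y \<in> carrier E"
    and vzero_closed: "vzero E \<in> carrier E"
    and vscale_closed: "x \<in> carrier E \<Longrightarrow> vscale E c x \<in> carrier E"
    and vadd_assoc: "x \<in> carrier E \<Longrightarrow> y \<in> carrier E \<Longrightarrow> z \<in> carrier E \<Longrightarrow>
      vadd E (vadd E x y) z = vadd E x (vadd E y z)"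
    and vadd_commute: "x \<in> carrier E \<Longrightarrow> y \<in> carrier E \<Longrightarrow> vadd E x y = vadd E y x"
    and vadd_vzero: "x \<in> carrier E \<Longrightarrow> vadd E x (vzero E) = x"
    and vadd_inverse: "x \<in> carrier E \<Longrightarrow> vadd E x (vscale E (- 1) x) = vzero E"
    and vscale_add_right: "x \<in> carrier E \<Longrightarrow> y \<in> carrier E \<Longrightarrow>
      vscale E c (vadd E x y) = vadd E (vscale E c x) (vscale E c y)"
    and vscale_add_left: "x \<in> carrier E \<Longrightarrow>
      vscale E (c + d) x = vadd E (vscale E c x) (vscale E d x)"
    and vscale_assoc: "x \<in> carrier E \<Longrightarrow> vscale E c (vscale E d x) = vscale E (c * d) x"
    and vscale_one: "x \<in> carrier E \<Longrightarrow> vscale E 1 x = x"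
    and vadd_mono: "x \<in> carrier E \<Longrightarrow> y \<in> carrier E \<Longrightarrow> z \<in> carrier E \<Longrightarrow> x \<sqsubseteq> y \<Longrightarrow>
      vadd E x z \<sqsubseteq> vadd E y z"
    and vscale_mono: "x \<in> carrier E \<Longrightarrow> y \<in> carrier E \<Longrightarrow> 0 \<le> c \<Longrightarrow> x \<sqsubseteq> y \<Longrightarrow>
      vscale E c x \<sqsubseteq> vscale E c y"

definition vabs :: "('e, 'm) ordered_vector_space_scheme \<Rightarrow> 'e \<Rightarrow> 'e" where
  "vabs E x = x \<squnion>\<^bsub>E\<^esub> vscale E (- 1) x"

definition lattice_ideal :: "('e, 'm) ordered_vector_space_scheme \<Rightarrow> 'e set \<Rightarrow> bool" where
  "lattice_ideal E M \<longleftrightarrow>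
     M \<subseteq> carrier E \<and> vzero E \<in> M \<and>
     (\<forall>x\<in>M. \<forall>y\<in>M. vadd E x y \<in> M) \<and> (\<forall>c. \<forall>x\<in>M. vscale E c x \<in> M) \<and>
     (\<forall>x\<in>carrier E. \<forall>y\<in>M. vabs E x \<sqsubseteq>\<^bsub>E\<^esub> vabs E y \<longrightarrow> x \<in> M)"

definition band :: "('e, 'm) ordered_vector_space_scheme \<Rightarrow> 'e set \<Rightarrow> bool" where
  "band E M \<longleftrightarrow>
     lattice_ideal E M \<and> (\<forall>A s. A \<subseteq> M \<longrightarrow> least E s (Upper E A) \<longrightarrow> s \<in> M)"

definition disjoint_complement ::
    "('e, 'm) ordered_vector_space_scheme \<Rightarrow> 'e set \<Rightarrow> 'e set" where
  "disjoint_complement E M =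
     {x \<in> carrier E. \<forall>y\<in>M. vabs E x \<sqinter>\<^bsub>E\<^esub> vabs E y = vzero E}"


section \<open>The vector lattice \<open>L\<^sub>p(\<mu>)\<close>\<close>

definition Lp_fun :: "'a measure \<Rightarrow> real \<Rightarrow> ('a \<Rightarrow> real) set" where
  "Lp_fun \<mu> p = {f \<in> borel_measurable \<mu>. integrable \<mu> (\<lambda>x. \<bar>f x\<bar> powr p)}"

definition Lp_rel :: "'a measure \<Rightarrow> real \<Rightarrow> (('a \<Rightarrow> real) \<times> ('a \<Rightarrow> real)) set" where
  "Lp_rel \<mu> p = {(f, g). f \<in> Lp_fun \<mu> p \<and> g \<in> Lp_fun \<mu> p \<and> (AE x in \<mu>. f x = g x)}"

definition Lp_class :: "'a measure \<Rightarrow> real \<Rightarrow> ('a \<Rightarrow> real) \<Rightarrow> ('a \<Rightarrow> real) set" where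
  "Lp_class \<mu> p f = Lp_rel \<mu> p `` {f}"

text \<open>
  The elements of \<open>L\<^sub>p(\<mu>)\<close> are the equivalence classes themselves. The order and the
  operations are defined through representatives; their independence of the representatives
  is shown below.
\<close>

definition Lp :: "'a measure \<Rightarrow> real \<Rightarrow> ('a \<Rightarrow> real) set ordered_vector_space" where
  "Lp \<mu> p =
    \<lparr> carrier = Lp_fun \<mu> p // Lp_rel \<mu> p,
      eq = (=),
      le = (\<lambda>F G. \<exists>f\<in>F. \<exists>g\<in>G. AE x in \<mu>. f x \<le> g x),
      vadd = (\<lambda>F G. \<Union>f\<in>F. \<Union>g\<in>G. Lp_class \<mu> p (\<lambda>x. f x + g x)),
      vzero = Lp_class \<mu> p (\<lambda>x. 0),
      vscale = (\<lambda>c F. \<Union>f\<in>F. Lp_class \<mu> p (\<lambda>x. c * f x)) \<rparr>"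

definition Lp_vanishing :: "'a measure \<Rightarrow> real \<Rightarrow> 'a measure \<Rightarrow> ('a \<Rightarrow> real) set set" where
  "Lp_vanishing \<mu> p \<nu> = {F \<in> carrier (Lp \<mu> p). \<forall>f\<in>F. AE x in \<nu>. f x = 0}"


section \<open>Locally disjoint decompositions\<close>

definition locally_disjoint :: "'a measure \<Rightarrow> 'a measure \<Rightarrow> 'a measure \<Rightarrow> bool" where
  "locally_disjoint \<mu> \<mu>' \<mu>'' \<longleftrightarrow>
     (\<forall>A\<in>sets \<mu>. emeasure \<mu> A < \<infinity> \<longrightarrow>
       (\<exists>A'\<in>sets \<mu>. \<exists>A''\<in>sets \<mu>. A = A' \<union> A'' \<and> A' \<inter> A'' = {} \<and>
         emeasure \<mu>' A'' = 0 \<and> emeasure \<mu>'' A' = 0))"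

text \<open>
  The conditions \<open>\<mu>' \<le> \<mu>\<close> and \<open>\<mu>'' \<le> \<mu>\<close>, under which local disjointness is considered, are
  consequences of \<open>\<mu> = \<mu>' + \<mu>''\<close>.
\<close>

definition locally_disjoint_decomposition ::
    "'a measure \<Rightarrow> 'a measure \<Rightarrow> 'a measure \<Rightarrow> bool" where
  "locally_disjoint_decomposition \<mu> \<mu>' \<mu>'' \<longleftrightarrow>
     sets \<mu>' = sets \<mu> \<and> sets \<mu>'' = sets \<mu> \<and>
     (\<forall>A\<in>sets \<mu>. emeasure \<mu> A = emeasure \<mu>' A + emeasure \<mu>'' A) \<and>
     locally_disjoint \<mu> \<mu>' \<mu>''"


section \<open>\<open>L\<^sub>p(\<mu>)\<close> is a vector lattice\<close>

lemma Lp_fun_bound: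
  assumes "f \<in> Lp_fun \<mu> p" "g \<in> Lp_fun \<mu> p" "h \<in> borel_measurable \<mu>" "0 \<le> p" "0 \<le> C"
    and le: "\<And>x. \<bar>h x\<bar> \<le> C * max \<bar>f x\<bar> \<bar>g x\<bar>"
  shows "h \<in> Lp_fun \<mu> p"
proof -
  have "integrable \<mu> (\<lambda>x. C powr p * (\<bar>f x\<bar> powr p + \<bar>g x\<bar> powr p))"
    using assms(1,2) by (simp add: Lp_fun_def)
  moreover have "\<bar>h x\<bar> powr p \<le> C powr p * (\<bar>f x\<bar> powr p + \<bar>g x\<bar> powr p)" for x
  proof -
    have "\<bar>h x\<bar> powr p \<le> (C * max \<bar>f x\<bar> \<bar>g x\<bar>) powr p"
      using le assms(4) by (intro powr_mono2) auto
    also have "\<dots> = C powr p * max \<bar>f x\<bar> \<bar>g x\<bar> powr p"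
      using assms(5) by (simp add: powr_mult)
    also have "\<dots> \<le> C powr p * (\<bar>f x\<bar> powr p + \<bar>g x\<bar> powr p)"
      by (intro mult_left_mono) (auto simp: max_def)
    finally show ?thesis .
  qed
  ultimately have "integrable \<mu> (\<lambda>x. \<bar>h x\<bar> powr p)"
    using assms(3) by (elim Bochner_Integration.integrable_bound) (auto intro!: AE_I2)
  then show ?thesis using assms(3) by (simp add: Lp_fun_def)
qed

lemma Lp_fun_add:
  assumes "f \<in> Lp_fun \<mu> p" "g \<in> Lp_fun \<mu> p" "1 \<le> p"
  shows "(\<lambda>x. f x + g x) \<in> Lp_fun \<mu> p"
  using assms(1,2)
  by (rule Lp_fun_bound[where C = 2]) (use assms in \<open>auto simp: Lp_fun_def\<close>)

lemma Lp_fun_zero: "(\<lambda>x. 0) \<in> Lp_fun \<mu> p"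
  by (simp add: Lp_fun_def)

lemma Lp_fun_scale:
  assumes "f \<in> Lp_fun \<mu> p" "1 \<le> p"
  shows "(\<lambda>x. c * f x) \<in> Lp_fun \<mu> p"
  using assms(1) assms(1)
  by (rule Lp_fun_bound[where C = "\<bar>c\<bar>"]) (use assms in \<open>auto simp: Lp_fun_def abs_mult\<close>)

lemma Lp_fun_uminus: "f \<in> Lp_fun \<mu> p \<Longrightarrow> (\<lambda>x. - f x) \<in> Lp_fun \<mu> p"
  by (simp add: Lp_fun_def)

lemma Lp_fun_max:
  assumes "f \<in> Lp_fun \<mu> p" "g \<in> Lp_fun \<mu> p" "1 \<le> p"
  shows "(\<lambda>x. max (f x) (g x)) \<in> Lp_fun \<mu> p"
  using assms(1,2)
  by (rule Lp_fun_bound[where C = 1]) (use assms in \<open>auto simp: Lp_fun_def\<close>)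

lemma Lp_fun_min:
  assumes "f \<in> Lp_fun \<mu> p" "g \<in> Lp_fun \<mu> p" "1 \<le> p"
  shows "(\<lambda>x. min (f x) (g x)) \<in> Lp_fun \<mu> p"
  using assms(1,2)
  by (rule Lp_fun_bound[where C = 1]) (use assms in \<open>auto simp: Lp_fun_def\<close>)

lemma mem_Lp_class_iff:
  "f \<in> Lp_fun \<mu> p \<Longrightarrow> g \<in> Lp_class \<mu> p f \<longleftrightarrow> g \<in> Lp_fun \<mu> p \<and> (AE x in \<mu>. f x = g x)"
  by (auto simp: Lp_class_def Lp_rel_def)

lemma Lp_class_refl: "f \<in> Lp_fun \<mu> p \<Longrightarrow> f \<in> Lp_class \<mu> p f"
  by (simp add: mem_Lp_class_iff)

lemma Lp_class_eq_iff:
  assumes "f \<in> Lp_fun \<mu> p" "g \<in> Lp_fun \<mu> p"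
  shows "Lp_class \<mu> p f = Lp_class \<mu> p g \<longleftrightarrow> (AE x in \<mu>. f x = g x)"
proof
  assume "Lp_class \<mu> p f = Lp_class \<mu> p g"
  then show "AE x in \<mu>. f x = g x"
    using Lp_class_refl[OF assms(2)] mem_Lp_class_iff[OF assms(1)] by blast
next
  assume *: "AE x in \<mu>. f x = g x"
  have "(AE x in \<mu>. f x = h x) \<longleftrightarrow> (AE x in \<mu>. g x = h x)" for h
    using * by (rule eventually_cong) simp
  then show "Lp_class \<mu> p f = Lp_class \<mu> p g"
    using assms by (auto simp: mem_Lp_class_iff)
qed

lemma carrier_Lp: "carrier (Lp \<mu> p) = Lp_class \<mu> p ` Lp_fun \<mu> p"
  by (auto simp: Lp_def quotient_def Lp_class_def)

lemma le_Lp_class: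
  assumes "f \<in> Lp_fun \<mu> p" "g \<in> Lp_fun \<mu> p"
  shows "Lp_class \<mu> p f \<sqsubseteq>\<^bsub>Lp \<mu> p\<^esub> Lp_class \<mu> p g \<longleftrightarrow> (AE x in \<mu>. f x \<le> g x)"
proof
  assume "Lp_class \<mu> p f \<sqsubseteq>\<^bsub>Lp \<mu> p\<^esub> Lp_class \<mu> p g"
  then obtain f' g' where "AE x in \<mu>. f x = f' x" "AE x in \<mu>. g x = g' x" "AE x in \<mu>. f' x \<le> g' x"
    using assms by (auto simp: Lp_def mem_Lp_class_iff)
  then show "AE x in \<mu>. f x \<le> g x" by eventually_elim simp
next
  assume "AE x in \<mu>. f x \<le> g x"
  then show "Lp_class \<mu> p f \<sqsubseteq>\<^bsub>Lp \<mu> p\<^esub> Lp_class \<mu> p g"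
    using assms by (auto simp: Lp_def intro: Lp_class_refl)
qed

lemma vadd_Lp_class:
  assumes "f \<in> Lp_fun \<mu> p" "g \<in> Lp_fun \<mu> p" "1 \<le> p"
  shows "vadd (Lp \<mu> p) (Lp_class \<mu> p f) (Lp_class \<mu> p g) = Lp_class \<mu> p (\<lambda>x. f x + g x)"
proof -
  have "Lp_class \<mu> p (\<lambda>x. f' x + g' x) = Lp_class \<mu> p (\<lambda>x. f x + g x)"
    if "f' \<in> Lp_class \<mu> p f" "g' \<in> Lp_class \<mu> p g" for f' g'
  proof -
    have f': "f' \<in> Lp_fun \<mu> p" "AE x in \<mu>. f x = f' x"
      using that assms by (auto simp: mem_Lp_class_iff)
    have g': "g' \<in> Lp_fun \<mu> p" "AE x in \<mu>. g x = g' x"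
      using that assms by (auto simp: mem_Lp_class_iff)
    have "AE x in \<mu>. f' x + g' x = f x + g x"
      using f'(2) g'(2) by eventually_elim simp
    then show ?thesis using f'(1) g'(1) assms by (simp add: Lp_class_eq_iff Lp_fun_add)
  qed
  moreover have "f \<in> Lp_class \<mu> p f" "g \<in> Lp_class \<mu> p g"
    using assms by (auto intro: Lp_class_refl)
  ultimately have "(\<Union>f'\<in>Lp_class \<mu> p f. \<Union>g'\<in>Lp_class \<mu> p g. Lp_class \<mu> p (\<lambda>x. f' x + g' x))
      = Lp_class \<mu> p (\<lambda>x. f x + g x)"
    by blast
  then show ?thesis by (simp add: Lp_def)
qed

lemma vscale_Lp_class:
  assumes "f \<in> Lp_fun \<mu> p" "1 \<le> p"
  shows "vscale (Lp \<mu> p) c (Lp_class \<mu> p f) = Lp_class \<mu> p (\<lambda>x. c * f x)"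
proof -
  have "Lp_class \<mu> p (\<lambda>x. c * f' x) = Lp_class \<mu> p (\<lambda>x. c * f x)"
    if "f' \<in> Lp_class \<mu> p f" for f'
  proof -
    have f': "f' \<in> Lp_fun \<mu> p" "AE x in \<mu>. f x = f' x"
      using that assms by (auto simp: mem_Lp_class_iff)
    have "AE x in \<mu>. c * f' x = c * f x"
      using f'(2) by eventually_elim simp
    then show ?thesis using f'(1) assms by (simp add: Lp_class_eq_iff Lp_fun_scale)
  qed
  moreover have "f \<in> Lp_class \<mu> p f"
    using assms by (auto intro: Lp_class_refl)
  ultimately have "(\<Union>f'\<in>Lp_class \<mu> p f. Lp_class \<mu> p (\<lambda>x. c * f' x))
      = Lp_class \<mu> p (\<lambda>x. c * f x)"
    by blast
  then show ?thesis by (simp add: Lp_def)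
qed

lemma vzero_Lp: "vzero (Lp \<mu> p) = Lp_class \<mu> p (\<lambda>x. 0)"
  by (simp add: Lp_def)

lemma eq_Lp: "eq (Lp \<mu> p) = (=)"
  by (simp add: Lp_def)

lemma partial_order_Lp: "partial_order (Lp \<mu> p)"
proof unfold_locales
  fix F G assume *: "F \<in> carrier (Lp \<mu> p)" "G \<in> carrier (Lp \<mu> p)"
    and le: "F \<sqsubseteq>\<^bsub>Lp \<mu> p\<^esub> G" "G \<sqsubseteq>\<^bsub>Lp \<mu> p\<^esub> F"
  obtain f g where fg: "f \<in> Lp_fun \<mu> p" "F = Lp_class \<mu> p f" "g \<in> Lp_fun \<mu> p" "G = Lp_class \<mu> p g"
    using * by (auto simp: carrier_Lp)
  have "AE x in \<mu>. f x \<le> g x" "AE x in \<mu>. g x \<le> f x"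
    using fg le by (auto simp: le_Lp_class)
  then have "AE x in \<mu>. f x = g x" by eventually_elim simp
  then have "F = G" using fg by (simp add: Lp_class_eq_iff)
  then show "F .=\<^bsub>Lp \<mu> p\<^esub> G" by (simp add: eq_Lp)
next
  fix F G H assume *: "F \<in> carrier (Lp \<mu> p)" "G \<in> carrier (Lp \<mu> p)" "H \<in> carrier (Lp \<mu> p)"
    and le: "F \<sqsubseteq>\<^bsub>Lp \<mu> p\<^esub> G" "G \<sqsubseteq>\<^bsub>Lp \<mu> p\<^esub> H"
  obtain f g h where fg: "f \<in> Lp_fun \<mu> p" "F = Lp_class \<mu> p f" "g \<in> Lp_fun \<mu> p" "G = Lp_class \<mu> p g"
      "h \<in> Lp_fun \<mu> p" "H = Lp_class \<mu> p h"
    using * by (auto simp: carrier_Lp)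
  have "AE x in \<mu>. f x \<le> g x" "AE x in \<mu>. g x \<le> h x"
    using fg le by (auto simp: le_Lp_class)
  then have "AE x in \<mu>. f x \<le> h x" by eventually_elim simp
  then show "F \<sqsubseteq>\<^bsub>Lp \<mu> p\<^esub> H" using fg by (simp add: le_Lp_class)
next
  fix F assume "F \<in> carrier (Lp \<mu> p)"
  then show "F \<sqsubseteq>\<^bsub>Lp \<mu> p\<^esub> F" by (auto simp: carrier_Lp le_Lp_class)
next
  show "(.=\<^bsub>Lp \<mu> p\<^esub>) = (=)" by (rule eq_Lp)
qed (simp_all add: eq_Lp)

lemma least_Lp_max:
  assumes "f \<in> Lp_fun \<mu> p" "g \<in> Lp_fun \<mu> p" "1 \<le> p"
  shows "least (Lp \<mu> p) (Lp_class \<mu> p (\<lambda>x. max (f x) (g x)))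
           (Upper (Lp \<mu> p) {Lp_class \<mu> p f, Lp_class \<mu> p g})"
  unfolding least_def
proof (intro conjI ballI)
  note m = Lp_fun_max[OF assms]
  show "Upper (Lp \<mu> p) {Lp_class \<mu> p f, Lp_class \<mu> p g} \<subseteq> carrier (Lp \<mu> p)"
    by (simp add: Upper_def)
  have "Lp_class \<mu> p f \<sqsubseteq>\<^bsub>Lp \<mu> p\<^esub> Lp_class \<mu> p (\<lambda>x. max (f x) (g x))" "Lp_class \<mu> p g \<sqsubseteq>\<^bsub>Lp \<mu> p\<^esub> Lp_class \<mu> p (\<lambda>x. max (f x) (g x))"
    using assms m by (simp_all add: le_Lp_class)
  moreover have "Lp_class \<mu> p (\<lambda>x. max (f x) (g x)) \<in> carrier (Lp \<mu> p)"
    using m by (simp add: carrier_Lp)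
  ultimately show "Lp_class \<mu> p (\<lambda>x. max (f x) (g x)) \<in> Upper (Lp \<mu> p) {Lp_class \<mu> p f, Lp_class \<mu> p g}"
    by (auto simp: Upper_def)
next
  fix H assume H: "H \<in> Upper (Lp \<mu> p) {Lp_class \<mu> p f, Lp_class \<mu> p g}"
  then obtain h where h: "h \<in> Lp_fun \<mu> p" "H = Lp_class \<mu> p h"
    by (auto simp: Upper_def carrier_Lp)
  have "Lp_class \<mu> p f \<sqsubseteq>\<^bsub>Lp \<mu> p\<^esub> H" "Lp_class \<mu> p g \<sqsubseteq>\<^bsub>Lp \<mu> p\<^esub> H"
    using H assms by (auto simp: Upper_def carrier_Lp)
  then have "AE x in \<mu>. f x \<le> h x" "AE x in \<mu>. g x \<le> h x"
    using assms h by (simp_all add: le_Lp_class)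
  then have "AE x in \<mu>. max (f x) (g x) \<le> h x" by eventually_elim simp
  then show "Lp_class \<mu> p (\<lambda>x. max (f x) (g x)) \<sqsubseteq>\<^bsub>Lp \<mu> p\<^esub> H"
    using h Lp_fun_max[OF assms] by (simp add: le_Lp_class)
qed

lemma greatest_Lp_min:
  assumes "f \<in> Lp_fun \<mu> p" "g \<in> Lp_fun \<mu> p" "1 \<le> p"
  shows "greatest (Lp \<mu> p) (Lp_class \<mu> p (\<lambda>x. min (f x) (g x)))
           (Lower (Lp \<mu> p) {Lp_class \<mu> p f, Lp_class \<mu> p g})"
  unfolding greatest_def
proof (intro conjI ballI)
  note m = Lp_fun_min[OF assms]
  show "Lower (Lp \<mu> p) {Lp_class \<mu> p f, Lp_class \<mu> p g} \<subseteq> carrier (Lp \<mu> p)"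
    by (simp add: Lower_def)
  have "Lp_class \<mu> p (\<lambda>x. min (f x) (g x)) \<sqsubseteq>\<^bsub>Lp \<mu> p\<^esub> Lp_class \<mu> p f" "Lp_class \<mu> p (\<lambda>x. min (f x) (g x)) \<sqsubseteq>\<^bsub>Lp \<mu> p\<^esub> Lp_class \<mu> p g"
    using assms m by (simp_all add: le_Lp_class)
  moreover have "Lp_class \<mu> p (\<lambda>x. min (f x) (g x)) \<in> carrier (Lp \<mu> p)"
    using m by (simp add: carrier_Lp)
  ultimately show "Lp_class \<mu> p (\<lambda>x. min (f x) (g x)) \<in> Lower (Lp \<mu> p) {Lp_class \<mu> p f, Lp_class \<mu> p g}"
    by (auto simp: Lower_def)
next
  fix H assume H: "H \<in> Lower (Lp \<mu> p) {Lp_class \<mu> p f, Lp_class \<mu> p g}"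
  then obtain h where h: "h \<in> Lp_fun \<mu> p" "H = Lp_class \<mu> p h"
    by (auto simp: Lower_def carrier_Lp)
  have "H \<sqsubseteq>\<^bsub>Lp \<mu> p\<^esub> Lp_class \<mu> p f" "H \<sqsubseteq>\<^bsub>Lp \<mu> p\<^esub> Lp_class \<mu> p g"
    using H assms by (auto simp: Lower_def carrier_Lp)
  then have "AE x in \<mu>. h x \<le> f x" "AE x in \<mu>. h x \<le> g x"
    using assms h by (simp_all add: le_Lp_class)
  then have "AE x in \<mu>. h x \<le> min (f x) (g x)" by eventually_elim simp
  then show "H \<sqsubseteq>\<^bsub>Lp \<mu> p\<^esub> Lp_class \<mu> p (\<lambda>x. min (f x) (g x))"
    using h Lp_fun_min[OF assms] by (simp add: le_Lp_class)
qed

theorem vector_lattice_Lp: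
  assumes p: "1 \<le> p"
  shows "vector_lattice (Lp \<mu> p)"
proof -
  interpret partial_order "Lp \<mu> p" by (rule partial_order_Lp)
  show ?thesis
  proof unfold_locales
    fix F G assume "F \<in> carrier (Lp \<mu> p)" "G \<in> carrier (Lp \<mu> p)"
    then show "\<exists>s. least (Lp \<mu> p) s (Upper (Lp \<mu> p) {F, G})"
      using least_Lp_max[OF _ _ p] unfolding carrier_Lp by blast
  next
    fix F G assume "F \<in> carrier (Lp \<mu> p)" "G \<in> carrier (Lp \<mu> p)"
    then show "\<exists>s. greatest (Lp \<mu> p) s (Lower (Lp \<mu> p) {F, G})"
      using greatest_Lp_min[OF _ _ p] unfolding carrier_Lp by blast
  next
    fix F G and c :: real
    assume *: "F \<in> carrier (Lp \<mu> p)" "G \<in> carrier (Lp \<mu> p)" and "0 \<le> c" "F \<sqsubseteq>\<^bsub>Lp \<mu> p\<^esub> G"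
    obtain f g where fg: "f \<in> Lp_fun \<mu> p" "F = Lp_class \<mu> p f" "g \<in> Lp_fun \<mu> p" "G = Lp_class \<mu> p g"
      using * by (auto simp: carrier_Lp)
    have "AE x in \<mu>. f x \<le> g x"
      using fg \<open>F \<sqsubseteq>\<^bsub>Lp \<mu> p\<^esub> G\<close> by (simp add: le_Lp_class)
    then have "AE x in \<mu>. c * f x \<le> c * g x"
      by eventually_elim (simp add: mult_left_mono \<open>0 \<le> c\<close>)
    then show "vscale (Lp \<mu> p) c F \<sqsubseteq>\<^bsub>Lp \<mu> p\<^esub> vscale (Lp \<mu> p) c G"
      using fg p by (simp add: vscale_Lp_class le_Lp_class Lp_fun_scale)
  qed (unfold carrier_Lp, safe,
      simp_all add: p vadd_Lp_class vscale_Lp_class vzero_Lp le_Lp_class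
        Lp_fun_add Lp_fun_scale Lp_fun_uminus Lp_fun_zero algebra_simps)
qed

end

theory Submission
  imports Defs
begin

text \<open>
  For a locally disjoint decomposition \<open>\<mu> = \<mu>' + \<mu>''\<close> a property holds \<open>\<mu>\<close>-a.e. iff it holds both
  \<open>\<mu>'\<close>-a.e. and \<open>\<mu>''\<close>-a.e. (\<open>AE_decomposition_iff\<close>). A function \<open>f\<close> in \<open>L\<^sub>p\<close> lives on countably many
  sets of finite measure, so although \<open>\<mu>'\<close> and \<open>\<mu>''\<close> are disjoint only locally, there is one
  measurable set \<open>D\<close> with \<open>f = 0\<close> \<open>\<mu>''\<close>-a.e. on \<open>D\<close> and \<open>f = 0\<close> \<open>\<mu>'\<close>-a.e. off \<open>D\<close>
  (\<open>decomposition_splits_Lp_fun\<close>). Truncating \<open>f\<close> to \<open>D\<close> therefore gives its component in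
  \<open>M = {f. f = 0 \<mu>''-a.e.}\<close>. If \<open>f\<close> is the supremum of a nonempty subset of \<open>M\<close>, its truncation is an upper bound
  too, and this forces \<open>f = 0\<close> \<open>\<mu>''\<close>-a.e.; if \<open>f\<close> is disjoint from \<open>M\<close>, it is disjoint from its own
  truncation, and this forces \<open>f = 0\<close> \<open>\<mu>'\<close>-a.e.

  Conversely, given a band \<open>M\<close>, let \<open>\<S>\<close> consist of the countable unions of supports of elements of
  \<open>M\<close> and put
  \<open>\<mu>' A = (SUP S\<in>\<S>. \<mu> (A \<inter> S))\<close> and \<open>\<mu>'' A = (INF S\<in>\<S>. \<mu> (A - S))\<close>.
  Since \<open>\<S>\<close> is closed under countable unions, a single \<open>S\<close> attains both extrema for countably many
  sets \<open>A\<close> at once. On those sets, \<open>\<mu>'\<close> and \<open>\<mu>''\<close> are the restrictions of \<open>\<mu>\<close> to \<open>S\<close> and to its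
  complement, and all required properties can be read off (\<open>decomposition_induced_by_sets\<close>).
  A function \<open>f\<close> vanishes \<open>\<mu>''\<close>-a.e. iff its support is covered, up to a \<open>\<mu>\<close>-null set, by the
  supports of countably many \<open>g\<^sub>n\<close> in \<open>M\<close>. Then \<open>\<bar>f\<bar>\<close> is the supremum of the functions
  \<open>min \<bar>f\<bar> (k \<bar>g\<^sub>n\<bar>)\<close>, which lie in \<open>M\<close>, so \<open>f\<close> lies in \<open>M\<close>
  (\<open>band_Lp_mem_if_support_covered\<close>). The claim about \<open>M\<^sup>\<bottom>\<close> is then the one for the decomposition.

  The infimum is used for \<open>\<mu>''\<close> because \<open>\<mu>\<close> need not be semifinite: an atom of infinite measure
  meets no element of \<open>L\<^sub>p\<close>, yet its mass has to be carried by \<open>\<mu>'\<close> or \<open>\<mu>''\<close>, and the infimum assigns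
  it to \<open>\<mu>''\<close>.
\<close>

section \<open>Lattice operations on representatives\<close>

lemma vabs_Lp_class:
  assumes "f \<in> Lp_fun \<mu> p" "1 \<le> p"
  shows "vabs (Lp \<mu> p) (Lp_class \<mu> p f) = Lp_class \<mu> p (\<lambda>x. \<bar>f x\<bar>)"
proof -
  interpret partial_order "Lp \<mu> p" by (rule partial_order_Lp)
  note neg = Lp_fun_scale[OF assms, of "-1"]
  have "least (Lp \<mu> p) (Lp_class \<mu> p (\<lambda>x. \<bar>f x\<bar>))
      (Upper (Lp \<mu> p) {Lp_class \<mu> p f, Lp_class \<mu> p (\<lambda>x. - 1 * f x)})"
  proof -
    have "(\<lambda>x. max (f x) (- 1 * f x)) = (\<lambda>x. \<bar>f x\<bar>)" by (auto simp: max_def)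
    then show ?thesis using least_Lp_max[OF assms(1) neg assms(2)] by simp
  qed
  then show ?thesis
    unfolding vabs_def vscale_Lp_class[OF assms] join_def sup_def
    by (intro some_equality) (simp_all only: least_unique)
qed

lemma meet_Lp_class:
  assumes "f \<in> Lp_fun \<mu> p" "g \<in> Lp_fun \<mu> p" "1 \<le> p"
  shows "Lp_class \<mu> p f \<sqinter>\<^bsub>Lp \<mu> p\<^esub> Lp_class \<mu> p g = Lp_class \<mu> p (\<lambda>x. min (f x) (g x))"
proof -
  interpret partial_order "Lp \<mu> p" by (rule partial_order_Lp)
  show ?thesis
    unfolding meet_def inf_def using greatest_Lp_min[OF assms]
    by (intro some_equality) (simp_all only: greatest_unique)
qed

lemma Lp_fun_abs: "f \<in> Lp_fun \<mu> p \<Longrightarrow> (\<lambda>x. \<bar>f x\<bar>) \<in> Lp_fun \<mu> p"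
  by (auto simp: Lp_fun_def)

lemma Lp_fun_indicator:
  assumes "f \<in> Lp_fun \<mu> p" "D \<in> sets \<mu>" "1 \<le> p"
  shows "(\<lambda>x. indicator D x * f x) \<in> Lp_fun \<mu> p"
  using assms(1) assms(1)
  by (rule Lp_fun_bound[where C = 1])
    (use assms in \<open>auto simp: Lp_fun_def indicator_def\<close>)

lemma disjoint_Lp_class_iff:
  assumes "f \<in> Lp_fun \<mu> p" "g \<in> Lp_fun \<mu> p" "1 \<le> p"
  shows "vabs (Lp \<mu> p) (Lp_class \<mu> p f) \<sqinter>\<^bsub>Lp \<mu> p\<^esub> vabs (Lp \<mu> p) (Lp_class \<mu> p g)
      = vzero (Lp \<mu> p) \<longleftrightarrow> (AE x in \<mu>. f x = 0 \<or> g x = 0)"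
proof -
  have "min \<bar>f x\<bar> \<bar>g x\<bar> = 0 \<longleftrightarrow> f x = 0 \<or> g x = 0" for x
    by (auto simp: min_def)
  then show ?thesis
    using assms
    by (simp add: vabs_Lp_class meet_Lp_class Lp_fun_abs vzero_Lp Lp_class_eq_iff Lp_fun_min
        Lp_fun_zero)
qed

lemma lattice_ideal_Lp_class:
  assumes "lattice_ideal (Lp \<mu> p) M" "Lp_class \<mu> p g \<in> M" "f \<in> Lp_fun \<mu> p" "g \<in> Lp_fun \<mu> p"
    "AE x in \<mu>. \<bar>f x\<bar> \<le> \<bar>g x\<bar>" "1 \<le> p"
  shows "Lp_class \<mu> p f \<in> M"
proof -
  have "vabs (Lp \<mu> p) (Lp_class \<mu> p f) \<sqsubseteq>\<^bsub>Lp \<mu> p\<^esub> vabs (Lp \<mu> p) (Lp_class \<mu> p g)"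
    using assms by (simp add: vabs_Lp_class le_Lp_class Lp_fun_abs)
  moreover have "Lp_class \<mu> p f \<in> carrier (Lp \<mu> p)"
    using assms(3) by (simp add: carrier_Lp)
  ultimately show ?thesis
    using assms(1,2) unfolding lattice_ideal_def by blast
qed

text \<open>
  An arbitrary set of classes is given by a set \<open>\<G>\<close> of representatives, so that suprema in \<open>L\<^sub>p\<close>
  become statements about a.e. inequalities between functions.
\<close>

lemma least_Lp_class_iff:
  assumes "\<G> \<subseteq> Lp_fun \<mu> p" and f: "f \<in> Lp_fun \<mu> p"
  shows "least (Lp \<mu> p) (Lp_class \<mu> p f) (Upper (Lp \<mu> p) (Lp_class \<mu> p ` \<G>))
    \<longleftrightarrow> (\<forall>g\<in>\<G>. AE x in \<mu>. g x \<le> f x) \<and>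
      (\<forall>h\<in>Lp_fun \<mu> p. (\<forall>g\<in>\<G>. AE x in \<mu>. g x \<le> h x) \<longrightarrow> (AE x in \<mu>. f x \<le> h x))"
proof -
  have U: "Upper (Lp \<mu> p) (Lp_class \<mu> p ` \<G>) =
      Lp_class \<mu> p ` {h \<in> Lp_fun \<mu> p. \<forall>g\<in>\<G>. AE x in \<mu>. g x \<le> h x}"
    (is "?U = ?V")
  proof -
    have *: "Lp_class \<mu> p h \<in> ?U \<longleftrightarrow> (\<forall>g\<in>\<G>. AE x in \<mu>. g x \<le> h x)" if "h \<in> Lp_fun \<mu> p" for h
      using assms that by (auto simp: Upper_def carrier_Lp le_Lp_class subset_eq)
    show ?thesis
    proof (intro equalityI subsetI)
      fix H assume H: "H \<in> ?U"
      then obtain h where h: "h \<in> Lp_fun \<mu> p" "H = Lp_class \<mu> p h"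
        by (auto simp: Upper_def carrier_Lp)
      then show "H \<in> ?V" using H *[OF h(1)] by simp
    next
      fix H assume "H \<in> ?V"
      then obtain h where h: "h \<in> Lp_fun \<mu> p" "\<forall>g\<in>\<G>. AE x in \<mu>. g x \<le> h x" "H = Lp_class \<mu> p h"
        by blast
      then show "H \<in> ?U" using *[OF h(1)] by simp
    qed
  qed
  have "Lp_class \<mu> p f \<in> ?V \<longleftrightarrow> (\<forall>g\<in>\<G>. AE x in \<mu>. g x \<le> f x)"
  proof
    assume "Lp_class \<mu> p f \<in> ?V"
    then have "Lp_class \<mu> p f \<in> ?U" by (simp only: U)
    then show "\<forall>g\<in>\<G>. AE x in \<mu>. g x \<le> f x"
      using assms by (auto simp: Upper_def carrier_Lp le_Lp_class subset_eq)
  qed (use f in auto)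
  moreover have "?V \<subseteq> carrier (Lp \<mu> p)" by (auto simp: carrier_Lp)
  ultimately show ?thesis
    unfolding least_def U using f by (auto simp: le_Lp_class)
qed


section \<open>The vanishing sets of a locally disjoint decomposition\<close>

text \<open>
  If \<open>P\<close> fails only on a \<open>\<mu>'\<close>-null set and only on a \<open>\<mu>''\<close>-null set, then it fails only on their
  intersection, which is null for the sum \<open>\<mu>\<close>.
\<close>

lemma AE_decomposition_iff:
  assumes "locally_disjoint_decomposition \<mu> \<mu>' \<mu>''"
  shows "(AE x in \<mu>. P x) \<longleftrightarrow> (AE x in \<mu>'. P x) \<and> (AE x in \<mu>''. P x)"
proof -
  have s: "sets \<mu>' = sets \<mu>" "sets \<mu>'' = sets \<mu>"
    and add: "\<And>A. A \<in> sets \<mu> \<Longrightarrow> emeasure \<mu> A = emeasure \<mu>' A + emeasure \<mu>'' A"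
    using assms by (auto simp: locally_disjoint_decomposition_def)
  have sp: "space \<mu>' = space \<mu>" "space \<mu>'' = space \<mu>"
    using s by (auto dest: sets_eq_imp_space_eq)
  have null: "N \<in> null_sets \<mu> \<longleftrightarrow> N \<in> null_sets \<mu>' \<and> N \<in> null_sets \<mu>''" for N
    using add by (auto simp: null_sets_def s)
  have inter: "N' \<inter> N'' \<in> null_sets \<mu>" if "N' \<in> null_sets \<mu>'" "N'' \<in> null_sets \<mu>''" for N' N''
    using that null by (metis null_setsD2 null_set_Int1 null_set_Int2 s)
  show ?thesis
  proof
    assume "AE x in \<mu>. P x"
    then show "(AE x in \<mu>'. P x) \<and> (AE x in \<mu>''. P x)"
      unfolding eventually_ae_filter sp using null by blast
  next
    assume "(AE x in \<mu>'. P x) \<and> (AE x in \<mu>''. P x)"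
    then obtain N' N'' where N: "N' \<in> null_sets \<mu>'" "{x \<in> space \<mu>. \<not> P x} \<subseteq> N'"
      "N'' \<in> null_sets \<mu>''" "{x \<in> space \<mu>. \<not> P x} \<subseteq> N''"
      unfolding eventually_ae_filter sp by blast
    then show "AE x in \<mu>. P x"
      unfolding eventually_ae_filter using inter[OF N(1,3)] N(2,4)
      by (intro bexI[of _ "N' \<inter> N''"]) auto
  qed
qed

text \<open>
  The second assumption is absolute continuity of \<open>\<nu>\<close> with respect to \<open>\<mu>\<close>; it makes the vanishing
  condition independent of the representative.
\<close>

lemma Lp_vanishing_class_iff:
  assumes "f \<in> Lp_fun \<mu> p" "\<And>P. AE x in \<mu>. P x \<Longrightarrow> AE x in \<nu>. P x"
  shows "Lp_class \<mu> p f \<in> Lp_vanishing \<mu> p \<nu> \<longleftrightarrow> (AE x in \<nu>. f x = 0)"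
proof
  assume "Lp_class \<mu> p f \<in> Lp_vanishing \<mu> p \<nu>"
  then show "AE x in \<nu>. f x = 0"
    using Lp_class_refl[OF assms(1)] by (auto simp: Lp_vanishing_def)
next
  assume f: "AE x in \<nu>. f x = 0"
  have "AE x in \<nu>. g x = 0" if "g \<in> Lp_class \<mu> p f" for g
  proof -
    have "AE x in \<mu>. f x = g x"
      using that assms(1) by (simp add: mem_Lp_class_iff)
    then have "AE x in \<nu>. f x = g x" by (rule assms(2))
    with f show ?thesis by eventually_elim simp
  qed
  then show "Lp_class \<mu> p f \<in> Lp_vanishing \<mu> p \<nu>"
    using assms(1) by (auto simp: Lp_vanishing_def carrier_Lp)
qed

text \<open>Markov's inequality bounds the measure of the sets \<open>{\<bar>f\<bar>\<^sup>p \<ge> 1 / (n + 1)}\<close>.\<close>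

lemma Lp_support_eq_UN:
  assumes "f \<in> Lp_fun \<mu> p"
  obtains A :: "nat \<Rightarrow> 'a set" where "range A \<subseteq> sets \<mu>" "\<forall>n. emeasure \<mu> (A n) < \<infinity>"
    "{x \<in> space \<mu>. f x \<noteq> 0} = (\<Union>n. A n)"
proof
  let ?A = "\<lambda>n. {x \<in> space \<mu>. \<bar>f x\<bar> powr p \<ge> inverse (real (Suc n))}"
  have [measurable]: "f \<in> borel_measurable \<mu>" and int: "integrable \<mu> (\<lambda>x. \<bar>f x\<bar> powr p)"
    using assms by (auto simp: Lp_fun_def)
  show "range ?A \<subseteq> sets \<mu>" by auto
  show "\<forall>n. emeasure \<mu> (?A n) < \<infinity>"
  proof
    fix n show "emeasure \<mu> (?A n) < \<infinity>"
      using integral_Markov_inequality[OF int, of "inverse (real (Suc n))"]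
      by (auto intro: le_less_trans)
  qed
  show "{x \<in> space \<mu>. f x \<noteq> 0} = (\<Union>n. ?A n)"
  proof safe
    fix x assume "x \<in> space \<mu>" "f x \<noteq> 0"
    then obtain n where "inverse (real (Suc n)) < \<bar>f x\<bar> powr p"
      using reals_Archimedean[of "\<bar>f x\<bar> powr p"] by auto
    then show "x \<in> (\<Union>n. ?A n)" using \<open>x \<in> space \<mu>\<close> by (auto intro!: exI[of _ n])
  next
    fix x n assume "inverse (real (Suc n)) \<le> \<bar>f x\<bar> powr p" "f x = 0"
    then show False by simp
  qed
qed

text \<open>
  Local disjointness splits each of the countably many finite-measure pieces \<open>A\<^sub>n\<close> of the support as
  \<open>A\<^sub>n' \<union> A\<^sub>n''\<close>, and \<open>D\<close> is the union of the \<open>A\<^sub>n'\<close>. A global set with this property for all \<open>f\<close>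
  need not exist when \<open>\<mu>\<close> is not \<open>\<sigma>\<close>-finite.
\<close>

lemma decomposition_splits_Lp_fun:
  assumes dec: "locally_disjoint_decomposition \<mu> \<mu>' \<mu>''" and f: "f \<in> Lp_fun \<mu> p"
  obtains D where "D \<in> sets \<mu>" "AE x in \<mu>''. x \<in> D \<longrightarrow> f x = 0" "AE x in \<mu>'. x \<notin> D \<longrightarrow> f x = 0"
proof -
  have s: "sets \<mu>' = sets \<mu>" "sets \<mu>'' = sets \<mu>"
    using dec by (auto simp: locally_disjoint_decomposition_def)
  obtain A :: "nat \<Rightarrow> 'a set" where A: "range A \<subseteq> sets \<mu>" "\<forall>n. emeasure \<mu> (A n) < \<infinity>"
    "{x \<in> space \<mu>. f x \<noteq> 0} = (\<Union>n. A n)"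
    by (rule Lp_support_eq_UN[OF f])
  have "\<exists>A' A''. A' \<in> sets \<mu> \<and> A'' \<in> sets \<mu> \<and> A n = A' \<union> A'' \<and>
      emeasure \<mu>' A'' = 0 \<and> emeasure \<mu>'' A' = 0" for n
  proof -
    have An: "A n \<in> sets \<mu>" "emeasure \<mu> (A n) < \<infinity>" using A(1,2) by auto
    have "locally_disjoint \<mu> \<mu>' \<mu>''"
      using dec by (simp add: locally_disjoint_decomposition_def)
    from this[unfolded locally_disjoint_def, rule_format, OF An]
    obtain A' A'' where "A' \<in> sets \<mu>" "A'' \<in> sets \<mu>" "A n = A' \<union> A''"
      "emeasure \<mu>' A'' = 0" "emeasure \<mu>'' A' = 0"
      by (elim bexE conjE)
    then show ?thesis by (intro exI[of _ A'] exI[of _ A''] conjI)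
  qed
  then obtain A' A'' :: "nat \<Rightarrow> 'a set" where
    A': "\<And>n. A' n \<in> sets \<mu>" "\<And>n. A'' n \<in> sets \<mu>" "\<And>n. A n = A' n \<union> A'' n"
    "\<And>n. emeasure \<mu>' (A'' n) = 0" "\<And>n. emeasure \<mu>'' (A' n) = 0"
    by metis
  show thesis
  proof
    show "(\<Union>n. A' n) \<in> sets \<mu>" using A' by auto
    have "AE x in \<mu>''. \<forall>n. x \<notin> A' n"
      unfolding AE_all_countable using A' s by (auto intro!: AE_not_in simp: null_sets_def)
    then show "AE x in \<mu>''. x \<in> (\<Union>n. A' n) \<longrightarrow> f x = 0"
      by eventually_elim simp
    have "AE x in \<mu>'. \<forall>n. x \<notin> A'' n"
      unfolding AE_all_countable using A' s by (auto intro!: AE_not_in simp: null_sets_def)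
    moreover have "AE x in \<mu>'. x \<in> space \<mu>"
      using AE_space[of \<mu>'] unfolding sets_eq_imp_space_eq[OF s(1)] .
    ultimately show "AE x in \<mu>'. x \<notin> (\<Union>n. A' n) \<longrightarrow> f x = 0"
    proof eventually_elim
      case (elim x)
      show ?case
      proof (intro impI, rule ccontr)
        assume "x \<notin> (\<Union>n. A' n)" "f x \<noteq> 0"
        have "x \<in> {x \<in> space \<mu>. f x \<noteq> 0}" using elim(2) \<open>f x \<noteq> 0\<close> by simp
        then obtain n where "x \<in> A n" unfolding A(3) by blast
        then show False
          using A'(3)[of n] elim(1) \<open>x \<notin> (\<Union>n. A' n)\<close> by simp
      qed
    qed
  qed
qed

lemma lattice_ideal_Lp_vanishing:
  assumes ac: "\<And>P. AE x in \<mu>. P x \<Longrightarrow> AE x in \<nu>. P x" and p: "1 \<le> p"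
  shows "lattice_ideal (Lp \<mu> p) (Lp_vanishing \<mu> p \<nu>)"
proof -
  note van = Lp_vanishing_class_iff[OF _ ac]
  have sub: "Lp_vanishing \<mu> p \<nu> \<subseteq> Lp_class \<mu> p ` Lp_fun \<mu> p"
    by (auto simp: Lp_vanishing_def carrier_Lp)
  show ?thesis
    unfolding lattice_ideal_def
  proof (intro conjI ballI allI impI)
    show "Lp_vanishing \<mu> p \<nu> \<subseteq> carrier (Lp \<mu> p)"
      using sub by (simp add: carrier_Lp)
    show "vzero (Lp \<mu> p) \<in> Lp_vanishing \<mu> p \<nu>"
      by (simp add: vzero_Lp van Lp_fun_zero)
  next
    fix F G assume FG: "F \<in> Lp_vanishing \<mu> p \<nu>" "G \<in> Lp_vanishing \<mu> p \<nu>"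
    then obtain f g where fg: "f \<in> Lp_fun \<mu> p" "F = Lp_class \<mu> p f" "g \<in> Lp_fun \<mu> p" "G = Lp_class \<mu> p g"
      using sub by blast
    have "AE x in \<nu>. f x = 0" "AE x in \<nu>. g x = 0"
      using FG fg by (simp_all add: van)
    then have "AE x in \<nu>. f x + g x = 0" by eventually_elim simp
    then show "vadd (Lp \<mu> p) F G \<in> Lp_vanishing \<mu> p \<nu>"
      using fg p by (simp add: vadd_Lp_class van Lp_fun_add)
  next
    fix c F assume F: "F \<in> Lp_vanishing \<mu> p \<nu>"
    then obtain f where f: "f \<in> Lp_fun \<mu> p" "F = Lp_class \<mu> p f"
      using sub by blast
    have "AE x in \<nu>. f x = 0"
      using F f by (simp add: van)
    then have "AE x in \<nu>. c * f x = 0" by eventually_elim simp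
    then show "vscale (Lp \<mu> p) c F \<in> Lp_vanishing \<mu> p \<nu>"
      unfolding f(2) vscale_Lp_class[OF f(1) p] by (subst van) (simp_all only: Lp_fun_scale[OF f(1) p])
  next
    fix F G assume F: "F \<in> carrier (Lp \<mu> p)" and G: "G \<in> Lp_vanishing \<mu> p \<nu>"
      and le: "vabs (Lp \<mu> p) F \<sqsubseteq>\<^bsub>Lp \<mu> p\<^esub> vabs (Lp \<mu> p) G"
    obtain f g where fg: "f \<in> Lp_fun \<mu> p" "F = Lp_class \<mu> p f" "g \<in> Lp_fun \<mu> p" "G = Lp_class \<mu> p g"
      using F G sub by (auto simp: carrier_Lp)
    have "AE x in \<nu>. g x = 0"
      using G fg by (simp add: van)
    moreover have "AE x in \<nu>. \<bar>f x\<bar> \<le> \<bar>g x\<bar>"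
      using le fg p by (intro ac) (simp add: vabs_Lp_class le_Lp_class Lp_fun_abs)
    ultimately have "AE x in \<nu>. f x = 0" by eventually_elim simp
    then show "F \<in> Lp_vanishing \<mu> p \<nu>"
      using fg by (simp add: van)
  qed
qed

text \<open>
  For closure under suprema: if the class of \<open>f\<close> is the supremum of \<open>\<F> \<noteq> {}\<close>, the truncation of \<open>f\<close>
  to the splitting set \<open>D\<close> is again an upper bound of \<open>\<F>\<close>, hence \<open>f\<close> is below it; so \<open>f \<le> 0\<close>
  \<open>\<mu>''\<close>-a.e., while \<open>f\<close> is above some member of \<open>\<F>\<close>, which vanishes \<open>\<mu>''\<close>-a.e.
\<close>

lemma band_Lp_vanishing:
  assumes dec: "locally_disjoint_decomposition \<mu> \<mu>' \<mu>''" and p: "1 \<le> p"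
  shows "band (Lp \<mu> p) (Lp_vanishing \<mu> p \<mu>'')"
  unfolding band_def
proof (intro conjI allI impI)
  note AE_iff = AE_decomposition_iff[OF dec]
  note van = Lp_vanishing_class_iff[OF _ AE_iff[THEN iffD1, THEN conjunct2]]
  show "lattice_ideal (Lp \<mu> p) (Lp_vanishing \<mu> p \<mu>'')"
    using AE_iff p by (intro lattice_ideal_Lp_vanishing) simp_all
  fix \<F> S
  assume \<F>: "\<F> \<subseteq> Lp_vanishing \<mu> p \<mu>''" and least: "least (Lp \<mu> p) S (Upper (Lp \<mu> p) \<F>)"
  have "\<F> \<subseteq> Lp_class \<mu> p ` Lp_fun \<mu> p"
    using \<F> by (auto simp: Lp_vanishing_def carrier_Lp)
  then obtain \<G> where \<G>: "\<G> \<subseteq> Lp_fun \<mu> p" "\<F> = Lp_class \<mu> p ` \<G>"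
    by (rule subset_imageE)
  have zero: "AE x in \<mu>''. g x = 0" if "g \<in> \<G>" for g
  proof -
    have "g \<in> Lp_fun \<mu> p" "Lp_class \<mu> p g \<in> Lp_vanishing \<mu> p \<mu>''"
      using \<F> \<G> that by blast+
    then show ?thesis by (simp add: van)
  qed
  have "S \<in> carrier (Lp \<mu> p)"
    using least by (auto simp: least_def Upper_def)
  then obtain f where f: "f \<in> Lp_fun \<mu> p" "S = Lp_class \<mu> p f"
    by (auto simp: carrier_Lp)
  have ub: "\<And>g. g \<in> \<G> \<Longrightarrow> AE x in \<mu>. g x \<le> f x"
    and lub: "\<And>h. h \<in> Lp_fun \<mu> p \<Longrightarrow> (\<And>g. g \<in> \<G> \<Longrightarrow> AE x in \<mu>. g x \<le> h x) \<Longrightarrow> AE x in \<mu>. f x \<le> h x"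
    using least_Lp_class_iff[OF \<G>(1) f(1)] least f(2) \<G>(2) by auto
  have "AE x in \<mu>''. f x = 0"
  proof (cases "\<G> = {}")
    case True
    \<comment> \<open>Every element is now an upper bound; \<open>f \<le> - 2 \<bar>f\<bar>\<close> is possible only where \<open>f = 0\<close>.\<close>
    have "(\<lambda>x. - 2 * \<bar>f x\<bar>) \<in> Lp_fun \<mu> p"
      by (intro Lp_fun_scale Lp_fun_abs f p)
    with True have "AE x in \<mu>. f x \<le> - 2 * \<bar>f x\<bar>"
      by (intro lub) auto
    then have "AE x in \<mu>. f x = 0" by eventually_elim arith
    then show ?thesis by (simp add: AE_iff)
  next
    case False
    then obtain g\<^sub>0 where g0: "g\<^sub>0 \<in> \<G>" by blast
    obtain D where D: "D \<in> sets \<mu>" "AE x in \<mu>''. x \<in> D \<longrightarrow> f x = 0" "AE x in \<mu>'. x \<notin> D \<longrightarrow> f x = 0"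
      by (rule decomposition_splits_Lp_fun[OF dec f(1)])
    have "AE x in \<mu>. f x \<le> indicator D x * f x"
    proof (rule lub)
      show "(\<lambda>x. indicator D x * f x) \<in> Lp_fun \<mu> p"
        by (rule Lp_fun_indicator[OF f(1) D(1) p])
      fix g assume g: "g \<in> \<G>"
      have le: "AE x in \<mu>'. g x \<le> f x" "AE x in \<mu>''. g x \<le> f x"
        using ub[OF g] by (simp_all add: AE_iff)
      have "AE x in \<mu>'. g x \<le> indicator D x * f x"
        using le(1) D(3) by eventually_elim (auto simp: indicator_def)
      moreover have "AE x in \<mu>''. g x \<le> indicator D x * f x"
        using le(2) zero[OF g] by eventually_elim (auto simp: indicator_def)
      ultimately show "AE x in \<mu>. g x \<le> indicator D x * f x" by (simp add: AE_iff)
    qed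
    then have "AE x in \<mu>''. f x \<le> indicator D x * f x" by (simp add: AE_iff)
    moreover have "AE x in \<mu>''. g\<^sub>0 x \<le> f x"
      using ub[OF g0] by (simp add: AE_iff)
    ultimately show ?thesis
      using zero[OF g0] D(2) by eventually_elim (auto simp: indicator_def split: if_splits)
  qed
  then show "S \<in> Lp_vanishing \<mu> p \<mu>''"
    using f by (simp add: van)
qed

text \<open>
  An \<open>f\<close> disjoint from the band is in particular disjoint from its own truncation to the splitting
  set \<open>D\<close>, which belongs to the band; so \<open>f = 0\<close> a.e. on \<open>D\<close>, and off \<open>D\<close> it vanishes \<open>\<mu>'\<close>-a.e.
\<close>

lemma disjoint_complement_Lp_vanishing:
  assumes dec: "locally_disjoint_decomposition \<mu> \<mu>' \<mu>''" and p: "1 \<le> p"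
  shows "disjoint_complement (Lp \<mu> p) (Lp_vanishing \<mu> p \<mu>'') = Lp_vanishing \<mu> p \<mu>'"
proof -
  note AE_iff = AE_decomposition_iff[OF dec]
  note van' = Lp_vanishing_class_iff[OF _ AE_iff[THEN iffD1, THEN conjunct1]]
  note van'' = Lp_vanishing_class_iff[OF _ AE_iff[THEN iffD1, THEN conjunct2]]
  have sub: "Lp_vanishing \<mu> p \<nu> \<subseteq> Lp_class \<mu> p ` Lp_fun \<mu> p" for \<nu>
    by (auto simp: Lp_vanishing_def carrier_Lp)
  have iff: "(\<forall>G\<in>Lp_vanishing \<mu> p \<mu>''. vabs (Lp \<mu> p) (Lp_class \<mu> p f) \<sqinter>\<^bsub>Lp \<mu> p\<^esub> vabs (Lp \<mu> p) G
      = vzero (Lp \<mu> p)) \<longleftrightarrow> Lp_class \<mu> p f \<in> Lp_vanishing \<mu> p \<mu>'" (is "?disj \<longleftrightarrow> ?van")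
    if f: "f \<in> Lp_fun \<mu> p" for f
  proof
    assume disj: ?disj
    obtain D where D: "D \<in> sets \<mu>" "AE x in \<mu>''. x \<in> D \<longrightarrow> f x = 0" "AE x in \<mu>'. x \<notin> D \<longrightarrow> f x = 0"
      by (rule decomposition_splits_Lp_fun[OF dec f])
    note fD = Lp_fun_indicator[OF f D(1) p]
    have "AE x in \<mu>''. indicator D x * f x = 0"
      using D(2) by eventually_elim (auto simp: indicator_def)
    then have "Lp_class \<mu> p (\<lambda>x. indicator D x * f x) \<in> Lp_vanishing \<mu> p \<mu>''"
      using fD by (simp add: van'')
    then have "AE x in \<mu>. f x = 0 \<or> indicator D x * f x = 0"
      using disj disjoint_Lp_class_iff[OF f fD p] by blast
    then have "AE x in \<mu>'. f x = 0 \<or> indicator D x * f x = 0"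
      by (simp only: AE_iff)
    with D(3) have "AE x in \<mu>'. f x = 0"
      by eventually_elim (auto simp: indicator_def split: if_splits)
    then show ?van using f by (simp add: van')
  next
    assume ?van
    then have f0: "AE x in \<mu>'. f x = 0" using f by (simp add: van')
    show ?disj
    proof
      fix G assume G: "G \<in> Lp_vanishing \<mu> p \<mu>''"
      then obtain g where g: "g \<in> Lp_fun \<mu> p" "G = Lp_class \<mu> p g"
        using sub by blast
      have g0: "AE x in \<mu>''. g x = 0"
        using G g by (simp add: van'')
      have "AE x in \<mu>. f x = 0 \<or> g x = 0"
        unfolding AE_iff using f0 g0 by (auto elim: eventually_mono)
      then show "vabs (Lp \<mu> p) (Lp_class \<mu> p f) \<sqinter>\<^bsub>Lp \<mu> p\<^esub> vabs (Lp \<mu> p) G = vzero (Lp \<mu> p)"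
        using disjoint_Lp_class_iff[OF f g(1) p] g(2) by simp
    qed
  qed
  show ?thesis
  proof (intro equalityI subsetI)
    fix F assume F: "F \<in> disjoint_complement (Lp \<mu> p) (Lp_vanishing \<mu> p \<mu>'')"
    then obtain f where f: "f \<in> Lp_fun \<mu> p" "F = Lp_class \<mu> p f"
      by (auto simp: disjoint_complement_def carrier_Lp)
    then show "F \<in> Lp_vanishing \<mu> p \<mu>'"
      using F iff[OF f(1)] by (simp add: disjoint_complement_def)
  next
    fix F assume F: "F \<in> Lp_vanishing \<mu> p \<mu>'"
    then obtain f where f: "f \<in> Lp_fun \<mu> p" "F = Lp_class \<mu> p f"
      using sub by blast
    then show "F \<in> disjoint_complement (Lp \<mu> p) (Lp_vanishing \<mu> p \<mu>'')"
      using F iff[OF f(1)] by (simp add: disjoint_complement_def carrier_Lp)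
  qed
qed


section \<open>Decompositions induced by a family of sets\<close>

lemma ennreal_SUP_eq_SUP_sequence:
  fixes f :: "'b \<Rightarrow> ennreal"
  assumes "I \<noteq> {}"
  shows "\<exists>s :: nat \<Rightarrow> 'b. range s \<subseteq> I \<and> (SUP i\<in>I. f i) = (SUP n. f (s n))"
proof -
  obtain e :: "nat \<Rightarrow> ennreal" where e: "range e \<subseteq> f ` I" "(SUP i\<in>I. f i) = (SUP n. e n)"
    using ennreal_Sup_countable_SUP[of "f ` I"] assms by blast
  from e(1) have "\<forall>n. \<exists>i. i \<in> I \<and> e n = f i" by blast
  from choice[OF this] obtain s where s: "\<forall>n. s n \<in> I \<and> e n = f (s n)" ..
  then have "range s \<subseteq> I" by blast
  moreover have "(SUP n. e n) = (SUP n. f (s n))" using s by simp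
  ultimately show ?thesis using e(2) by (intro exI[where x = s]) simp
qed

lemma ennreal_INF_eq_INF_sequence:
  fixes f :: "'b \<Rightarrow> ennreal"
  assumes "I \<noteq> {}"
  shows "\<exists>s :: nat \<Rightarrow> 'b. range s \<subseteq> I \<and> (INF i\<in>I. f i) = (INF n. f (s n))"
proof -
  obtain e :: "nat \<Rightarrow> ennreal" where e: "range e \<subseteq> f ` I" "(INF i\<in>I. f i) = (INF n. e n)"
    using ennreal_Inf_countable_INF[of "f ` I"] assms by blast
  from e(1) have "\<forall>n. \<exists>i. i \<in> I \<and> e n = f i" by blast
  from choice[OF this] obtain s where s: "\<forall>n. s n \<in> I \<and> e n = f (s n)" ..
  then have "range s \<subseteq> I" by blast
  moreover have "(INF n. e n) = (INF n. f (s n))" using s by simp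
  ultimately show ?thesis using e(2) by (intro exI[where x = s]) simp
qed

text \<open>
  The two set functions behave like restrictions of \<open>\<mu>\<close> to a largest member of \<open>\<S>\<close> and to its
  complement. A largest member need not exist, but for any countable collection of sets some
  member of \<open>\<S>\<close> serves as one (fact \<open>common\<close>), and countable additivity, \<open>\<mu> = \<mu>' + \<mu>''\<close> and local
  disjointness each involve only countably many sets.
\<close>

lemma decomposition_induced_by_sets:
  fixes \<mu> :: "'a measure"
  assumes ne: "\<S> \<noteq> {}" and sub: "\<S> \<subseteq> sets \<mu>"
    and UN: "\<And>S :: nat \<Rightarrow> 'a set. range S \<subseteq> \<S> \<Longrightarrow> (\<Union>n. S n) \<in> \<S>"
  obtains \<mu>' \<mu>'' where "locally_disjoint_decomposition \<mu> \<mu>' \<mu>''"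
    "\<forall>A\<in>sets \<mu>. emeasure \<mu>'' A = 0 \<longleftrightarrow> (\<exists>S\<in>\<S>. emeasure \<mu> (A - S) = 0)"
proof -
  define m' where "m' A = (SUP S\<in>\<S>. emeasure \<mu> (A \<inter> S))" for A
  define m'' where "m'' A = (INF S\<in>\<S>. emeasure \<mu> (A - S))" for A
  have m'_le: "emeasure \<mu> (A \<inter> S) \<le> m' A" if "S \<in> \<S>" for A S
    unfolding m'_def using that by (rule SUP_upper)
  have m''_le: "m'' A \<le> emeasure \<mu> (A - S)" if "S \<in> \<S>" for A S
    unfolding m''_def using that by (rule INF_lower)
  have Un: "T \<union> U \<in> \<S>" if "T \<in> \<S>" "U \<in> \<S>" for T U
  proof -
    have "(\<Union>n::nat. if n = 0 then T else U) \<in> \<S>" using that by (intro UN) auto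
    moreover have "(\<Union>n::nat. if n = 0 then T else U) = T \<union> U" by (auto split: if_splits)
    ultimately show ?thesis by simp
  qed
  have common: "\<exists>S\<in>\<S>. \<forall>n. m' (A n) = emeasure \<mu> (A n \<inter> S) \<and> m'' (A n) = emeasure \<mu> (A n - S)"
    if A: "range A \<subseteq> sets \<mu>" for A :: "nat \<Rightarrow> 'a set"
  proof -
    have "\<forall>n. \<exists>S :: nat \<Rightarrow> 'a set. range S \<subseteq> \<S> \<and> m' (A n) = (SUP i. emeasure \<mu> (A n \<inter> S i))"
      using ennreal_SUP_eq_SUP_sequence[OF ne, of "\<lambda>S. emeasure \<mu> (A _ \<inter> S)"]
      by (simp add: m'_def)
    from choice[OF this] obtain S' :: "nat \<Rightarrow> nat \<Rightarrow> 'a set" where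
      "\<forall>n. range (S' n) \<subseteq> \<S> \<and> m' (A n) = (SUP i. emeasure \<mu> (A n \<inter> S' n i))" ..
    then have S': "range (S' n) \<subseteq> \<S>" "m' (A n) = (SUP i. emeasure \<mu> (A n \<inter> S' n i))" for n
      by simp_all
    have "\<forall>n. \<exists>S :: nat \<Rightarrow> 'a set. range S \<subseteq> \<S> \<and> m'' (A n) = (INF i. emeasure \<mu> (A n - S i))"
      using ennreal_INF_eq_INF_sequence[OF ne, of "\<lambda>S. emeasure \<mu> (A _ - S)"]
      by (simp add: m''_def)
    from choice[OF this] obtain S'' :: "nat \<Rightarrow> nat \<Rightarrow> 'a set" where
      "\<forall>n. range (S'' n) \<subseteq> \<S> \<and> m'' (A n) = (INF i. emeasure \<mu> (A n - S'' n i))" ..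
    then have S'': "range (S'' n) \<subseteq> \<S>" "m'' (A n) = (INF i. emeasure \<mu> (A n - S'' n i))" for n
      by simp_all
    define S where "S = (\<Union>n. (\<Union>i. S' n i)) \<union> (\<Union>n. (\<Union>i. S'' n i))"
    have S: "S \<in> \<S>"
      unfolding S_def by (intro Un UN image_subsetI S'(1) S''(1))
    have meas: "A n \<inter> S \<in> sets \<mu>" "\<And>T. T \<in> \<S> \<Longrightarrow> A n - T \<in> sets \<mu>" for n
      using A S sub by auto
    show ?thesis
    proof (intro bexI[OF _ S] allI conjI antisym m'_le[OF S] m''_le[OF S])
      fix n
      have "emeasure \<mu> (A n \<inter> S' n i) \<le> emeasure \<mu> (A n \<inter> S)" for i
        by (rule emeasure_mono[OF _ meas(1)]) (auto simp: S_def)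
      then show "m' (A n) \<le> emeasure \<mu> (A n \<inter> S)"
        unfolding S'(2) by (rule SUP_least)
      have "emeasure \<mu> (A n - S) \<le> emeasure \<mu> (A n - S'' n i)" for i
        by (rule emeasure_mono[OF _ meas(2)]) (use S''(1) in \<open>auto simp: S_def\<close>)
      then show "emeasure \<mu> (A n - S) \<le> m'' (A n)"
        unfolding S''(2) by (rule INF_greatest)
    qed
  qed
  have single: "\<exists>S\<in>\<S>. m' A = emeasure \<mu> (A \<inter> S) \<and> m'' A = emeasure \<mu> (A - S)"
    if "A \<in> sets \<mu>" for A
    using common[of "\<lambda>_. A"] that by auto
  have additive: "(\<Sum>n. m' (A n)) = m' (\<Union>n. A n) \<and> (\<Sum>n. m'' (A n)) = m'' (\<Union>n. A n)"
    if A: "range A \<subseteq> sets \<mu>" "disjoint_family A" for A :: "nat \<Rightarrow> 'a set"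
  proof -
    \<comment> \<open>One member of \<open>\<S>\<close> has to be optimal for the union and for all of its parts.\<close>
    define B where "B n = (case n of 0 \<Rightarrow> (\<Union>n. A n) | Suc k \<Rightarrow> A k)" for n
    have "range B \<subseteq> sets \<mu>" using A(1) by (auto simp: B_def split: nat.split)
    then obtain S where S: "S \<in> \<S>" and
      B: "\<And>n. m' (B n) = emeasure \<mu> (B n \<inter> S)" "\<And>n. m'' (B n) = emeasure \<mu> (B n - S)"
      using common[of B] by metis
    have *: "S \<in> sets \<mu>" using S sub by blast
    have "range (\<lambda>n. A n \<inter> S) \<subseteq> sets \<mu>" "range (\<lambda>n. A n - S) \<subseteq> sets \<mu>"
      using A(1) * by blast+
    moreover have "disjoint_family (\<lambda>n. A n \<inter> S)" "disjoint_family (\<lambda>n. A n - S)"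
      using A(2) unfolding disjoint_family_on_def by blast+
    ultimately have "(\<Sum>n. emeasure \<mu> (A n \<inter> S)) = emeasure \<mu> (\<Union>n. A n \<inter> S)"
      "(\<Sum>n. emeasure \<mu> (A n - S)) = emeasure \<mu> (\<Union>n. A n - S)"
      by (simp_all only: suminf_emeasure)
    moreover have "m' (A n) = emeasure \<mu> (A n \<inter> S)" "m'' (A n) = emeasure \<mu> (A n - S)" for n
      using B(1)[of "Suc n"] B(2)[of "Suc n"] by (simp_all add: B_def)
    moreover have "(\<Union>n. A n \<inter> S) = B 0 \<inter> S" "(\<Union>n. A n - S) = B 0 - S" "(\<Union>n. A n) = B 0"
      by (auto simp: B_def)
    ultimately show ?thesis
      using B(1)[of 0] B(2)[of 0] by simp
  qed
  have zero: "m' {} = 0" "m'' {} = 0"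
    using single[of "{}"] by auto
  define \<mu>' where "\<mu>' = measure_of (space \<mu>) (sets \<mu>) m'"
  define \<mu>'' where "\<mu>'' = measure_of (space \<mu>) (sets \<mu>) m''"
  have s: "sets \<mu>' = sets \<mu>" "sets \<mu>'' = sets \<mu>"
    by (simp_all add: \<mu>'_def \<mu>''_def)
  have \<mu>': "emeasure \<mu>' A = m' A" if "A \<in> sets \<mu>" for A
    unfolding \<mu>'_def using that additive zero
    by (intro emeasure_measure_of_sigma)
      (auto simp: positive_def countably_additive_def sets.sigma_algebra_axioms)
  have \<mu>'': "emeasure \<mu>'' A = m'' A" if "A \<in> sets \<mu>" for A
    unfolding \<mu>''_def using that additive zero
    by (intro emeasure_measure_of_sigma)
      (auto simp: positive_def countably_additive_def sets.sigma_algebra_axioms)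
  show thesis
  proof
    show "\<forall>A\<in>sets \<mu>. emeasure \<mu>'' A = 0 \<longleftrightarrow> (\<exists>S\<in>\<S>. emeasure \<mu> (A - S) = 0)"
    proof
      fix A assume A: "A \<in> sets \<mu>"
      then show "emeasure \<mu>'' A = 0 \<longleftrightarrow> (\<exists>S\<in>\<S>. emeasure \<mu> (A - S) = 0)"
        using single[OF A] m''_le[of _ A] \<mu>''[OF A] by (metis le_zero_eq)
    qed
    have "locally_disjoint \<mu> \<mu>' \<mu>''"
      unfolding locally_disjoint_def
    proof (intro ballI impI)
      fix A assume A: "A \<in> sets \<mu>" and fin: "emeasure \<mu> A < \<infinity>"
      obtain S where S: "S \<in> \<S>" "m' A = emeasure \<mu> (A \<inter> S)" using single[OF A] by blast
      have [measurable]: "S \<in> sets \<mu>" "A \<in> sets \<mu>" using S sub A by auto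
      have "emeasure \<mu>'' (A \<inter> S) = 0"
        using m''_le[OF S(1), of "A \<inter> S"] \<mu>''[of "A \<inter> S"] by (simp add: Int_Diff)
      \<comment> \<open>If some \<open>T\<close> met \<open>A - S\<close> in positive measure, \<open>S \<union> T\<close> would exceed the finite supremum
        \<open>m' A\<close>, which \<open>S\<close> attains.\<close>
      moreover have "m' (A - S) = 0"
      proof -
        obtain T where T: "T \<in> \<S>" "m' (A - S) = emeasure \<mu> ((A - S) \<inter> T)"
          using single[of "A - S"] by auto
        have [measurable]: "T \<in> sets \<mu>" using T sub by auto
        have "emeasure \<mu> (A \<inter> S) + m' (A - S) = emeasure \<mu> ((A \<inter> S) \<union> ((A - S) \<inter> T))"
          unfolding T(2) by (rule plus_emeasure) auto
        also have "(A \<inter> S) \<union> ((A - S) \<inter> T) = A \<inter> (S \<union> T)" by auto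
        also have "emeasure \<mu> (A \<inter> (S \<union> T)) \<le> emeasure \<mu> (A \<inter> S)"
          using m'_le[OF Un[OF S(1) T(1)], of A] S(2) by simp
        finally have le: "emeasure \<mu> (A \<inter> S) + m' (A - S) \<le> emeasure \<mu> (A \<inter> S) + 0" by simp
        have "emeasure \<mu> (A \<inter> S) \<le> emeasure \<mu> A" by (rule emeasure_mono) auto
        then have "emeasure \<mu> (A \<inter> S) < \<infinity>" using fin by (rule le_less_trans)
        then show ?thesis using le by (auto simp: ennreal_add_left_cancel_le)
      qed
      ultimately show "\<exists>A'\<in>sets \<mu>. \<exists>A''\<in>sets \<mu>. A = A' \<union> A'' \<and> A' \<inter> A'' = {} \<and>
         emeasure \<mu>' A'' = 0 \<and> emeasure \<mu>'' A' = 0"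
        using \<mu>' by (intro bexI[of _ "A \<inter> S"] bexI[of _ "A - S"]) auto
    qed
    moreover have "emeasure \<mu> A = emeasure \<mu>' A + emeasure \<mu>'' A" if A: "A \<in> sets \<mu>" for A
    proof -
      obtain S where S: "S \<in> \<S>" "m' A = emeasure \<mu> (A \<inter> S)" "m'' A = emeasure \<mu> (A - S)"
        using single[OF A] by blast
      have "S \<in> sets \<mu>" using S(1) sub by blast
      then have "emeasure \<mu> A = emeasure \<mu> (A \<inter> S) + emeasure \<mu> (A - S)"
        using A by (subst plus_emeasure) (auto intro!: arg_cong[where f = "emeasure \<mu>"])
      then show ?thesis using S \<mu>'[OF A] \<mu>''[OF A] by simp
    qed
    ultimately show "locally_disjoint_decomposition \<mu> \<mu>' \<mu>''"
      using s by (simp add: locally_disjoint_decomposition_def)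
  qed
qed


section \<open>Bands are vanishing sets\<close>

lemma le_if_min_multiples_le:
  fixes a b :: real
  assumes "0 < b" "\<And>k::nat. min a (real k * b) \<le> h"
  shows "a \<le> h"
proof -
  obtain k :: nat where "a < real k * b"
    using reals_Archimedean3[OF assms(1)] by blast
  then show ?thesis using assms(2)[of k] by simp
qed

text \<open>
  Where \<open>g\<^sub>n \<noteq> 0\<close>, the functions \<open>min \<bar>f\<bar> (k \<bar>g\<^sub>n\<bar>)\<close> reach \<open>\<bar>f\<bar>\<close> for large \<open>k\<close>. Hence \<open>\<bar>f\<bar>\<close> is their
  supremum over all \<open>k\<close> and \<open>n\<close>, and each of them lies in the ideal.
\<close>

lemma band_Lp_mem_if_support_covered:
  fixes g :: "nat \<Rightarrow> 'a \<Rightarrow> real"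
  assumes band: "band (Lp \<mu> p) M" and p: "1 \<le> p" and f: "f \<in> Lp_fun \<mu> p"
    and g: "\<And>n. g n \<in> Lp_fun \<mu> p" "\<And>n. Lp_class \<mu> p (g n) \<in> M"
    and cover: "AE x in \<mu>. f x \<noteq> 0 \<longrightarrow> (\<exists>n. g n x \<noteq> 0)"
  shows "Lp_class \<mu> p f \<in> M"
proof -
  have ideal: "lattice_ideal (Lp \<mu> p) M"
    and sup: "\<And>A s. A \<subseteq> M \<Longrightarrow> least (Lp \<mu> p) s (Upper (Lp \<mu> p) A) \<Longrightarrow> s \<in> M"
    using band by (auto simp: band_def)
  define t where "t n k = (\<lambda>x. min \<bar>f x\<bar> (real k * \<bar>g n x\<bar>))" for n k
  define \<G> where "\<G> = (\<Union>n. range (t n))"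
  have t: "t n k \<in> Lp_fun \<mu> p" for n k
    unfolding t_def by (intro Lp_fun_min Lp_fun_abs Lp_fun_scale f g p)
  have "Lp_class \<mu> p (t n k) \<in> M" for n k
  proof (rule lattice_ideal_Lp_class[OF ideal _ t _ _ p])
    show kg: "(\<lambda>x. real k * g n x) \<in> Lp_fun \<mu> p" by (intro Lp_fun_scale g p)
    have "vscale (Lp \<mu> p) (real k) (Lp_class \<mu> p (g n)) \<in> M"
      using ideal g(2) by (simp add: lattice_ideal_def)
    then show "Lp_class \<mu> p (\<lambda>x. real k * g n x) \<in> M"
      by (simp only: vscale_Lp_class[OF g(1) p])
    show "AE x in \<mu>. \<bar>t n k x\<bar> \<le> \<bar>real k * g n x\<bar>"
      by (auto simp: t_def abs_mult)
  qed
  then have sub: "Lp_class \<mu> p ` \<G> \<subseteq> M" by (auto simp: \<G>_def)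
  have "AE x in \<mu>. \<bar>f x\<bar> \<le> h x"
    if h: "\<And>u. u \<in> \<G> \<Longrightarrow> AE x in \<mu>. u x \<le> h x" for h
  proof -
    have "AE x in \<mu>. \<forall>n k. t n k x \<le> h x"
      unfolding AE_all_countable using h by (auto simp: \<G>_def)
    with cover show ?thesis
    proof eventually_elim
      case (elim x)
      show ?case
      proof (cases "f x = 0")
        case True
        then show ?thesis using elim(2)[rule_format, of 0 0] by (simp add: t_def)
      next
        case False
        then obtain n where n: "g n x \<noteq> 0" using elim(1) by blast
        show ?thesis
        proof (rule le_if_min_multiples_le)
          show "0 < \<bar>g n x\<bar>" using n by simp
          show "min \<bar>f x\<bar> (real k * \<bar>g n x\<bar>) \<le> h x" for k
            using elim(2)[rule_format, of n k] by (simp only: t_def)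
        qed
      qed
    qed
  qed
  moreover have "AE x in \<mu>. u x \<le> \<bar>f x\<bar>" if "u \<in> \<G>" for u
    using that by (auto simp: \<G>_def t_def)
  moreover have "\<G> \<subseteq> Lp_fun \<mu> p" using t by (auto simp: \<G>_def)
  ultimately have "least (Lp \<mu> p) (Lp_class \<mu> p (\<lambda>x. \<bar>f x\<bar>)) (Upper (Lp \<mu> p) (Lp_class \<mu> p ` \<G>))"
    using least_Lp_class_iff[of \<G> \<mu> p, OF _ Lp_fun_abs[OF f]] by blast
  then have "Lp_class \<mu> p (\<lambda>x. \<bar>f x\<bar>) \<in> M"
    using sup[OF sub] by blast
  then show ?thesis
    by (rule lattice_ideal_Lp_class[OF ideal _ f Lp_fun_abs[OF f] _ p]) simp
qed

text \<open>
  Taking countable unions of supports as the family \<open>\<S>\<close>, rather than the supports themselves, makes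
  closure under countable unions immediate; no element of \<open>M\<close> whose support is such a union has to
  be constructed.
\<close>

lemma band_Lp_eq_vanishing:
  assumes band: "band (Lp \<mu> p) M" and p: "1 \<le> p"
  obtains \<mu>' \<mu>'' where "locally_disjoint_decomposition \<mu> \<mu>' \<mu>''" "M = Lp_vanishing \<mu> p \<mu>''"
proof -
  define R where "R = {f \<in> Lp_fun \<mu> p. Lp_class \<mu> p f \<in> M}"
  define supp where "supp f = {x \<in> space \<mu>. f x \<noteq> 0}" for f :: "'a \<Rightarrow> real"
  define \<S> where "\<S> = {\<Union>n. supp (g n) |g :: nat \<Rightarrow> 'a \<Rightarrow> real. range g \<subseteq> R}"
  have ideal: "lattice_ideal (Lp \<mu> p) M" using band by (simp add: band_def)
  then have M_sub: "M \<subseteq> Lp_class \<mu> p ` Lp_fun \<mu> p"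
    by (simp add: lattice_ideal_def carrier_Lp)
  have "vzero (Lp \<mu> p) \<in> M" using ideal by (simp add: lattice_ideal_def)
  then have "(\<lambda>x. 0) \<in> R" by (simp add: R_def vzero_Lp Lp_fun_zero)
  then have ne: "\<S> \<noteq> {}" by (auto simp: \<S>_def)
  have supp_sets: "supp f \<in> sets \<mu>" if "f \<in> Lp_fun \<mu> p" for f
    unfolding supp_def using that by (auto simp: Lp_fun_def)
  have sub: "\<S> \<subseteq> sets \<mu>"
    using supp_sets by (auto simp: \<S>_def R_def intro!: sets.countable_UN)
  have UN: "(\<Union>n. S n) \<in> \<S>" if "range S \<subseteq> \<S>" for S :: "nat \<Rightarrow> 'a set"
  proof -
    have "\<forall>n. \<exists>g :: nat \<Rightarrow> 'a \<Rightarrow> real. range g \<subseteq> R \<and> S n = (\<Union>k. supp (g k))"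
      using that unfolding \<S>_def by blast
    from choice[OF this] obtain g :: "nat \<Rightarrow> nat \<Rightarrow> 'a \<Rightarrow> real" where
      "\<forall>n. range (g n) \<subseteq> R \<and> S n = (\<Union>k. supp (g n k))" ..
    then have g: "range (g n) \<subseteq> R" "S n = (\<Union>k. supp (g n k))" for n
      by simp_all
    define e where "e i = (case prod_decode i of (n, k) \<Rightarrow> g n k)" for i
    have "g n k \<in> R" for n k using g(1)[of n] by blast
    then have "range e \<subseteq> R" by (auto simp: e_def split: prod.split)
    moreover have "(\<Union>n. S n) = (\<Union>i. supp (e i))"
    proof (intro equalityI subsetI)
      fix x assume "x \<in> (\<Union>n. S n)"
      then obtain n k where "x \<in> supp (g n k)" unfolding g(2) by blast
      then have "x \<in> supp (e (prod_encode (n, k)))" by (simp add: e_def)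
      then show "x \<in> (\<Union>i. supp (e i))" by blast
    next
      fix x assume "x \<in> (\<Union>i. supp (e i))"
      then obtain i where "x \<in> supp (e i)" by blast
      then have "x \<in> supp (g (fst (prod_decode i)) (snd (prod_decode i)))"
        by (simp add: e_def split_beta)
      then show "x \<in> (\<Union>n. S n)" unfolding g(2) by blast
    qed
    ultimately show ?thesis unfolding \<S>_def by blast
  qed
  obtain \<mu>' \<mu>'' where dec: "locally_disjoint_decomposition \<mu> \<mu>' \<mu>''"
    and null: "\<forall>A\<in>sets \<mu>. emeasure \<mu>'' A = 0 \<longleftrightarrow> (\<exists>S\<in>\<S>. emeasure \<mu> (A - S) = 0)"
    by (rule decomposition_induced_by_sets[OF ne sub UN])
  note AE_iff = AE_decomposition_iff[OF dec]
  note van = Lp_vanishing_class_iff[OF _ AE_iff[THEN iffD1, THEN conjunct2]]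
  have s: "sets \<mu>'' = sets \<mu>" using dec by (simp add: locally_disjoint_decomposition_def)
  have van_iff: "Lp_class \<mu> p f \<in> Lp_vanishing \<mu> p \<mu>'' \<longleftrightarrow> (\<exists>S\<in>\<S>. emeasure \<mu> (supp f - S) = 0)"
    if f: "f \<in> Lp_fun \<mu> p" for f
    using supp_sets[OF f] null[rule_format, OF supp_sets[OF f]] s sets_eq_imp_space_eq[OF s]
    by (simp add: van[OF f] AE_iff_measurable[of "supp f"] supp_def)
  have mem_iff: "Lp_class \<mu> p f \<in> M \<longleftrightarrow> Lp_class \<mu> p f \<in> Lp_vanishing \<mu> p \<mu>''" if f: "f \<in> Lp_fun \<mu> p" for f
  proof
    assume "Lp_class \<mu> p f \<in> M"
    then have "range (\<lambda>_::nat. f) \<subseteq> R" using f by (simp add: R_def)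
    then have "(\<Union>n::nat. supp f) \<in> \<S>" unfolding \<S>_def by (intro CollectI exI[of _ "\<lambda>_. f"]) simp
    then show "Lp_class \<mu> p f \<in> Lp_vanishing \<mu> p \<mu>''"
      unfolding van_iff[OF f] by (intro bexI) simp_all
  next
    assume "Lp_class \<mu> p f \<in> Lp_vanishing \<mu> p \<mu>''"
    then obtain g :: "nat \<Rightarrow> 'a \<Rightarrow> real" where g: "range g \<subseteq> R" "emeasure \<mu> (supp f - (\<Union>n. supp (g n))) = 0"
      unfolding van_iff[OF f] \<S>_def by blast
    have g': "g n \<in> Lp_fun \<mu> p" "Lp_class \<mu> p (g n) \<in> M" for n
      using g(1) by (auto simp: R_def)
    have "supp f - (\<Union>n. supp (g n)) \<in> null_sets \<mu>"
      using g(2) supp_sets[OF f] supp_sets[OF g'(1)] by (auto simp: null_sets_def)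
    then have "AE x in \<mu>. f x \<noteq> 0 \<longrightarrow> (\<exists>n. g n x \<noteq> 0)"
      by (rule AE_I') (auto simp: supp_def)
    then show "Lp_class \<mu> p f \<in> M"
      by (rule band_Lp_mem_if_support_covered[OF band p f g'])
  qed
  have "M = Lp_vanishing \<mu> p \<mu>''"
  proof (intro equalityI subsetI)
    fix F assume F: "F \<in> M"
    then obtain f where f: "f \<in> Lp_fun \<mu> p" "F = Lp_class \<mu> p f"
      using M_sub by blast
    then show "F \<in> Lp_vanishing \<mu> p \<mu>''" using F mem_iff[OF f(1)] by simp
  next
    fix F assume F: "F \<in> Lp_vanishing \<mu> p \<mu>''"
    then obtain f where f: "f \<in> Lp_fun \<mu> p" "F = Lp_class \<mu> p f"
      by (auto simp: Lp_vanishing_def carrier_Lp)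
    then show "F \<in> M" using F mem_iff[OF f(1)] by simp
  qed
  with dec show thesis by (rule that)
qed


section \<open>The correspondence\<close>

theorem theorem2p2:
  fixes \<mu> :: "'a measure" and p :: real
  assumes "1 \<le> p"
  shows "(\<forall>\<mu>' \<mu>''. locally_disjoint_decomposition \<mu> \<mu>' \<mu>'' \<longrightarrow>
            band (Lp \<mu> p) (Lp_vanishing \<mu> p \<mu>'') \<and>
            disjoint_complement (Lp \<mu> p) (Lp_vanishing \<mu> p \<mu>'') = Lp_vanishing \<mu> p \<mu>')
       \<and> (\<forall>M. band (Lp \<mu> p) M \<longrightarrow>
            (\<exists>\<mu>' \<mu>''. locally_disjoint_decomposition \<mu> \<mu>' \<mu>'' \<and>
               M = Lp_vanishing \<mu> p \<mu>'' \<and>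
               disjoint_complement (Lp \<mu> p) M = Lp_vanishing \<mu> p \<mu>'))"
proof (intro conjI allI impI)
  fix \<mu>' \<mu>'' assume dec: "locally_disjoint_decomposition \<mu> \<mu>' \<mu>''"
  show "band (Lp \<mu> p) (Lp_vanishing \<mu> p \<mu>'')"
    by (rule band_Lp_vanishing[OF dec assms])
  show "disjoint_complement (Lp \<mu> p) (Lp_vanishing \<mu> p \<mu>'') = Lp_vanishing \<mu> p \<mu>'"
    by (rule disjoint_complement_Lp_vanishing[OF dec assms])
next
  fix M assume "band (Lp \<mu> p) M"
  then obtain \<mu>' \<mu>'' where dec: "locally_disjoint_decomposition \<mu> \<mu>' \<mu>''"
    and M: "M = Lp_vanishing \<mu> p \<mu>''"
    using assms by (rule band_Lp_eq_vanishing)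
  have "disjoint_complement (Lp \<mu> p) M = Lp_vanishing \<mu> p \<mu>'"
    unfolding M by (rule disjoint_complement_Lp_vanishing[OF dec assms])
  with dec M show "\<exists>\<mu>' \<mu>''. locally_disjoint_decomposition \<mu> \<mu>' \<mu>'' \<and>
      M = Lp_vanishing \<mu> p \<mu>'' \<and> disjoint_complement (Lp \<mu> p) M = Lp_vanishing \<mu> p \<mu>'"
    by blast
qed

end
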